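(* Assume $d\ge5$. For every $y>1+2\sum_{x\in\mathbb Z^d}G_d(x)^2$ there are constants $\underline c,\bar c>0$ such that for all sufficiently large $n$ $$\exp(-\bar c\sqrt n)\ \ge\ \mathbb P_0\left(\sum_{x\in\mathbb Z^d}l_n^2(x)\ge ny\right)\ \ge\ \exp(-\underline c\sqrt n).$$
   Context: $(S_k)_{k\ge0}$ is the nearest-neighbour symmetric (simple) random walk on $\mathbb Z^d$ with $S_0=0$, with law $\mathbb P_0$ and expectation $\mathbb E_0$. Local times: $l_n(x)=\sum_{k=0}^n\mathbf 1\{S_k=x\}$, $l_\infty(x)=\sum_{k\ge0}\mathbf 1\{S_k=x\}$. Green kernel: $G_d(x)=\mathbb E_0[l_\infty(x)]$. *)

theory Defs
  imports "HOL-Probability.Probability"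
begin

definition unit_steps :: "(int ^ 'd) set" where
  "unit_steps = range (\<lambda>i. axis i 1) \<union> range (\<lambda>i. - axis i 1)"

text \<open>
  The law of the simple random walk on \<open>\<int>\<^sup>d\<close> (\<open>d = CARD('d)\<close>) started at the origin is realised on
  the space of increment sequences: under \<open>srw_law\<close> the coordinates \<open>\<omega> 0, \<omega> 1, \<dots>\<close> are independent
  and uniform on the \<open>2 d\<close> unit steps, and \<open>srw k \<omega>\<close> is the position \<open>S\<^sub>k\<close>.
\<close>

definition srw_law :: "(nat \<Rightarrow> int ^ 'd) measure" where
  "srw_law = (\<Pi>\<^sub>M k\<in>UNIV. measure_pmf (pmf_of_set unit_steps))"

definition srw :: "nat \<Rightarrow> (nat \<Rightarrow> int ^ 'd) \<Rightarrow> int ^ 'd" where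
  "srw k \<omega> = (\<Sum>j<k. \<omega> j)"

definition local_time :: "nat \<Rightarrow> int ^ 'd \<Rightarrow> (nat \<Rightarrow> int ^ 'd) \<Rightarrow> nat" where
  "local_time n x \<omega> = (\<Sum>k=0..n. of_bool (srw k \<omega> = x))"

text \<open>
  The total local time and the Green kernel take values in \<open>[0, \<infinity>]\<close>, so that no finiteness
  has to be presupposed.
\<close>

definition total_local_time :: "int ^ 'd \<Rightarrow> (nat \<Rightarrow> int ^ 'd) \<Rightarrow> ennreal" where
  "total_local_time x \<omega> = (\<Sum>k. of_bool (srw k \<omega> = x))"

definition green :: "int ^ 'd \<Rightarrow> ennreal" where
  "green x = (\<integral>\<^sup>+\<omega>. total_local_time x \<omega> \<partial>srw_law)"

end

theory Submission
  imports Defs "HOL-Real_Asymp.Real_Asymp"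
begin

text \<open>
  The hypothesis on \<open>y\<close> says that \<open>B = \<Sum>\<^sub>x G(x)\<^sup>2\<close> is finite and smaller than \<open>(y - 1) / 2\<close>; no heat
  kernel estimate is needed beyond this. Since \<open>\<Sum>\<^sub>x l\<^sub>n(x)\<^sup>2 = n + 1 + 2 V\<^sub>n\<close> with \<open>V\<^sub>n\<close> the number of
  pairs \<open>i < j \<le> n\<close> such that \<open>S\<^sub>i = S\<^sub>j\<close>, and since \<open>G(0) \<le> G(0)\<^sup>2 \<le> B\<close>, the event forces \<open>V\<^sub>n\<close> to
  exceed its mean rate \<open>G(0) - 1\<close> by a positive amount per step.

  Let \<open>\<psi>\<^sub>n = \<Sum>\<^sub>i\<^sub>\<le>\<^sub>n (G(S\<^sub>n - S\<^sub>i) - 1{S\<^sub>n = S\<^sub>i})\<close> be the expected number of future visits to the sites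
  visited so far, and suppose the Green potentials \<open>\<Sum>\<^sub>i\<^sub>\<le>\<^sub>j G(S\<^sub>j - S\<^sub>i)\<close>, \<open>j \<le> n\<close>, stay below \<open>a\<close>.
  Then, for \<open>\<theta> a < 1\<close> and \<open>c = \<theta> / (1 - \<theta> a)\<close>, the process \<open>exp(\<theta> V\<^sub>n) (1 + c \<psi>\<^sub>n)\<close> grows in mean by
  a factor of at most \<open>1 + c (G(0) - 1)\<close> per step. With \<open>a = \<surd>n\<close> and \<open>\<theta>\<close> a suitable multiple of \<open>1 / \<surd>n\<close>,
  Markov's inequality gives the bound \<open>exp(- const \<surd>n)\<close>. By time reversal the potential at
  time \<open>j\<close> has the law of \<open>\<Sum>\<^sub>i\<^sub>\<le>\<^sub>j G(S\<^sub>i)\<close>, which has an exponential moment (Khas'minskii's argument,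
  with \<open>G * G \<le> B\<close>), so it exceeds \<open>\<surd>n\<close> only with probability \<open>2 exp(- \<surd>n / (2 B))\<close>.

  For the lower bound the walk oscillates between two neighbours for about \<open>2 \<surd>(n y)\<close> steps.
\<close>

section \<open>Averages over one step\<close>

definition step_mean :: "(int ^ 'd \<Rightarrow> real) \<Rightarrow> real" where
  "step_mean h = (\<Sum>e\<in>unit_steps. h e) / card (unit_steps :: (int ^ 'd) set)"

lemma finite_unit_steps [simp]: "finite (unit_steps :: (int ^ 'd::finite) set)"
  by (simp add: unit_steps_def)

lemma unit_steps_nonempty [simp]: "(unit_steps :: (int ^ 'd::finite) set) \<noteq> {}"
  by (simp add: unit_steps_def)

lemma card_unit_steps_pos [simp]: "0 < card (unit_steps :: (int ^ 'd::finite) set)"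
  by (simp add: card_gt_0_iff)

lemma uminus_unit_steps: "uminus ` unit_steps = (unit_steps :: (int ^ 'd::finite) set)"
  by (simp add: unit_steps_def image_Un image_image Un_commute)

lemma step_mean_const [simp]: "step_mean (\<lambda>e::int ^ 'd::finite. c) = c"
  by (simp add: step_mean_def)

lemma step_mean_add: "step_mean (\<lambda>e. h e + h' e) = step_mean h + step_mean h'"
  by (simp add: step_mean_def sum.distrib add_divide_distrib)

lemma step_mean_cmult: "step_mean (\<lambda>e. c * h e) = c * step_mean h"
  by (simp add: step_mean_def sum_distrib_left)

lemma step_mean_sum: "step_mean (\<lambda>e. \<Sum>i\<in>I. h i e) = (\<Sum>i\<in>I. step_mean (h i))"
  unfolding step_mean_def by (subst sum.swap) (simp add: sum_divide_distrib)

lemma step_mean_mono: "(\<And>e. h e \<le> h' e) \<Longrightarrow> step_mean h \<le> step_mean h'"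
  by (simp add: step_mean_def divide_right_mono sum_mono)

lemma step_mean_nonneg: "(\<And>e. 0 \<le> h e) \<Longrightarrow> 0 \<le> step_mean h"
  by (simp add: step_mean_def sum_nonneg)

lemma step_mean_uminus: "step_mean (\<lambda>e. h (- e)) = step_mean (h :: int ^ 'd::finite \<Rightarrow> real)"
proof -
  have "(\<Sum>e\<in>unit_steps. h (- e)) = (\<Sum>e\<in>uminus ` unit_steps. h e)"
    by (subst sum.reindex) (auto simp: o_def)
  then show ?thesis by (simp add: step_mean_def uminus_unit_steps)
qed

section \<open>The law of the walk: measurability and conditioning on the past\<close>

lemma prob_space_srw_law: "prob_space (srw_law :: (nat \<Rightarrow> int ^ 'd::finite) measure)"
  unfolding srw_law_def by (intro prob_space_PiM prob_space_measure_pmf)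

interpretation srw: prob_space "srw_law :: (nat \<Rightarrow> int ^ 'd::finite) measure"
  by (rule prob_space_srw_law)

lemma space_srw_law [simp]: "space (srw_law :: (nat \<Rightarrow> int ^ 'd::finite) measure) = UNIV"
  by (simp add: srw_law_def space_PiM)

lemma measurable_coord [measurable]:
  "(\<lambda>w. w k) \<in> srw_law \<rightarrow>\<^sub>M count_space (UNIV :: (int ^ 'd::finite) set)"
proof -
  have "(\<lambda>w. w k) \<in> srw_law \<rightarrow>\<^sub>M measure_pmf (pmf_of_set (unit_steps :: (int ^ 'd) set))"
    unfolding srw_law_def by measurable
  then show ?thesis by (simp cong: measurable_cong_sets)
qed

text \<open>Steps take values in a countable set, so a function of the first \<open>n\<close> steps
  factors through the discrete countable space of lists, on which every map is measurable.\<close>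

lemma measurable_prefix:
  assumes "\<And>w w'. (\<And>i. i < n \<Longrightarrow> w i = w' i) \<Longrightarrow> F w = F w'" and "range F \<subseteq> space N"
  shows "F \<in> (srw_law :: (nat \<Rightarrow> int ^ 'd::finite) measure) \<rightarrow>\<^sub>M N"
proof -
  have "(\<lambda>w. map w [0..<n]) \<in> (srw_law :: (nat \<Rightarrow> int ^ 'd) measure) \<rightarrow>\<^sub>M count_space UNIV"
  proof (rule measurable_count_space_eq2_countable[THEN iffD2], intro conjI ballI)
    fix xs :: "(int ^ 'd) list"
    have "map w [0..<n] = xs \<longleftrightarrow> length xs = n \<and> (\<forall>i<n. w i = xs ! i)" for w
      by (auto intro: nth_equalityI)
    then have "(\<lambda>w. map w [0..<n]) -` {xs} = {w. length xs = n \<and> (\<forall>i<n. w i = xs ! i)}"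
      by (simp only: vimage_def singleton_iff)
    moreover have "{w \<in> space srw_law. length xs = n \<and> (\<forall>i\<in>{..<n}. w i = xs ! i)} \<in> sets srw_law"
      using measurable_sets[OF measurable_coord, of "{xs ! i}" i for i]
      by (intro sets.sets_Collect_conj sets.sets_Collect_const sets.sets_Collect_finite_All)
         (auto simp: vimage_def)
    ultimately show "(\<lambda>w. map w [0..<n]) -` {xs} \<inter> space srw_law \<in> sets srw_law"
      by (simp add: Ball_def)
  qed auto
  \<comment> \<open>Filling the sequence with 0 from index \<open>n\<close> on leaves
    \<open>F\<close> unchanged and exhibits it as a function of the list.\<close>
  then have "(\<lambda>w. F (\<lambda>i. if i < n then map w [0..<n] ! i else 0)) \<in> srw_law \<rightarrow>\<^sub>M N"
    by (rule measurable_compose[where g = "\<lambda>xs. F (\<lambda>i. if i < n then xs ! i else 0)"])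
      (use assms(2) in auto)
  also have "(\<lambda>w. F (\<lambda>i. if i < n then map w [0..<n] ! i else 0)) = F"
    by (intro ext assms(1)) auto
  finally show ?thesis .
qed

text \<open>Resampling the step at time \<open>k\<close> replaces conditioning on the first \<open>k\<close> steps.\<close>

lemma nn_integral_resample:
  fixes F :: "(nat \<Rightarrow> int ^ 'd::finite) \<Rightarrow> real"
  assumes [measurable]: "F \<in> borel_measurable srw_law" and nn: "\<And>w. 0 \<le> F w"
  shows "(\<integral>\<^sup>+w. ennreal (F w) \<partial>srw_law) =
    (\<integral>\<^sup>+w. ennreal (step_mean (\<lambda>e. F (w(k := e)))) \<partial>srw_law)"
proof -
  let ?P = "measure_pmf (pmf_of_set (unit_steps :: (int ^ 'd) set))"
  let ?S = "srw_law :: (nat \<Rightarrow> int ^ 'd) measure"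
  interpret P: pair_sigma_finite ?P ?S
    by (intro pair_sigma_finite.intro prob_space_imp_sigma_finite prob_space_measure_pmf
        prob_space_srw_law)
  \<comment> \<open>Overwriting one coordinate by an independent copy preserves the product
    law.\<close>
  have eq: "distr (?P \<Otimes>\<^sub>M ?S) ?S (\<lambda>(x, X). X(k := x)) = ?S"
    using distr_pair_PiM_eq_PiM[of UNIV "\<lambda>_. ?P" k]
    by (simp add: srw_law_def prob_space_measure_pmf)
  have [measurable]: "(\<lambda>(x, X). X(k := x)) \<in> ?P \<Otimes>\<^sub>M ?S \<rightarrow>\<^sub>M ?S"
    unfolding srw_law_def case_prod_beta by (rule measurable_fun_upd[where J = UNIV]) auto
  have "(\<integral>\<^sup>+w. ennreal (F w) \<partial>?S) = (\<integral>\<^sup>+z. ennreal (F ((\<lambda>(x, X). X(k := x)) z)) \<partial>(?P \<Otimes>\<^sub>M ?S))"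
    by (subst (1) eq[symmetric], subst nn_integral_distr) auto
  also have "\<dots> = (\<integral>\<^sup>+X. \<integral>\<^sup>+x. ennreal (F (X(k := x))) \<partial>?P \<partial>?S)"
    by (subst P.nn_integral_snd[symmetric]) (auto simp: case_prod_beta)
  also have "\<dots> = (\<integral>\<^sup>+w. ennreal (step_mean (\<lambda>e. F (w(k := e)))) \<partial>srw_law)"
    by (intro nn_integral_cong)
      (simp add: nn_integral_pmf_of_set step_mean_def sum_ennreal nn sum_nonneg divide_ennreal
        ennreal_of_nat_eq_real_of_nat)
  finally show ?thesis .
qed

text \<open>As \<open>W n\<close> ignores the steps from index \<open>n\<close> on, averaging over
  step \<open>n\<close> plays the part of the conditional expectation given the past. Filtrations
  are thereby replaced by the pointwise inequality \<open>step\<close>, which resampling turns into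
  a bound on the mean.\<close>

lemma nn_integral_supermartingale:
  fixes W :: "nat \<Rightarrow> (nat \<Rightarrow> int ^ 'd::finite) \<Rightarrow> real"
  assumes dep: "\<And>n w w'. (\<And>i. i < n \<Longrightarrow> w i = w' i) \<Longrightarrow> W n w = W n w'"
    and nn: "\<And>n w. 0 \<le> W n w" and r: "0 \<le> r" and init: "\<And>w. W 0 w \<le> b"
    and step: "\<And>n w. step_mean (\<lambda>e. W (Suc n) (w(n := e))) \<le> r * W n w"
  shows "(\<integral>\<^sup>+w. ennreal (W n w) \<partial>srw_law) \<le> ennreal (b * r ^ n)"
proof (induction n)
  case 0
  have "(\<integral>\<^sup>+w. ennreal (W 0 w) \<partial>srw_law) \<le> (\<integral>\<^sup>+w. ennreal b \<partial>(srw_law :: (nat \<Rightarrow> int ^ 'd) measure))"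
    by (intro nn_integral_mono ennreal_leI init)
  then show ?case by (simp add: srw.emeasure_space_1 flip: space_srw_law)
next
  case (Suc n)
  have meas: "W n \<in> borel_measurable srw_law" for n
    by (rule measurable_prefix[OF dep]) auto
  have "(\<integral>\<^sup>+w. ennreal (W (Suc n) w) \<partial>srw_law) =
      (\<integral>\<^sup>+w. ennreal (step_mean (\<lambda>e. W (Suc n) (w(n := e)))) \<partial>srw_law)"
    by (rule nn_integral_resample[OF meas nn])
  also have "\<dots> \<le> (\<integral>\<^sup>+w. ennreal r * ennreal (W n w) \<partial>srw_law)"
    by (intro nn_integral_mono) (simp add: step ennreal_leI r flip: ennreal_mult')
  also have "\<dots> = ennreal r * (\<integral>\<^sup>+w. ennreal (W n w) \<partial>srw_law)"
    using meas by (intro nn_integral_cmult) auto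
  also have "\<dots> \<le> ennreal r * ennreal (b * r ^ n)"
    by (intro mult_left_mono Suc) auto
  also have "\<dots> = ennreal (b * r ^ Suc n)"
    by (simp add: r mult_ac flip: ennreal_mult')
  finally show ?case .
qed

lemma srw_0 [simp]: "srw 0 w = 0"
  by (simp add: srw_def)

lemma srw_cong: "(\<And>i. i < k \<Longrightarrow> w i = w' i) \<Longrightarrow> srw k w = srw k w'"
  by (auto simp: srw_def intro!: sum.cong)

lemma srw_upd [simp]: "k \<le> n \<Longrightarrow> srw k (w(n := e)) = srw k w"
  by (intro srw_cong) auto

lemma srw_upd_Suc [simp]: "srw (Suc n) (w(n := e)) = srw n w + e"
  by (simp add: srw_def)

lemma measurable_srw [measurable]:
  "srw k \<in> srw_law \<rightarrow>\<^sub>M count_space (UNIV :: (int ^ 'd::finite) set)"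
  by (rule measurable_prefix[of k]) (auto intro: srw_cong)

lemma borel_measurable_of_bool_srw [measurable]:
  "(\<lambda>w. of_bool (srw k w = (x :: int ^ 'd::finite)) :: 'b::{topological_space, zero_neq_one})
    \<in> borel_measurable srw_law"
  by (rule measurable_prefix[of k]) (simp_all cong: srw_cong)

section \<open>Transition probabilities and the Green kernel\<close>

definition srw_prob :: "nat \<Rightarrow> int ^ 'd \<Rightarrow> real" where
  "srw_prob k x = \<P>(w in srw_law. srw k w = x)"

lemma srw_prob_0: "srw_prob 0 (x :: int ^ 'd::finite) = of_bool (x = 0)"
  using srw.prob_space by (auto simp: srw_prob_def)

lemma srw_prob_eq: "ennreal (srw_prob k (x :: int ^ 'd::finite)) = (\<integral>\<^sup>+w. of_bool (srw k w = x)
    \<partial>srw_law)"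
proof -
  have meas: "{w \<in> space srw_law. srw k w = x} \<in> sets srw_law"
    by measurable
  have "(\<integral>\<^sup>+w. of_bool (srw k w = x) \<partial>srw_law) = (\<integral>\<^sup>+w. indicator {w. srw k w = x} w \<partial>srw_law)"
    by (intro nn_integral_cong) (auto simp: indicator_def)
  also have "\<dots> = emeasure srw_law {w \<in> space srw_law. srw k w = x}"
    using meas by (subst nn_integral_indicator) simp_all
  finally show ?thesis by (simp add: srw_prob_def srw.emeasure_eq_measure)
qed

text \<open>The last increment of the path has index \<open>k\<close>; resampling it gives the
  recursion.\<close>

lemma srw_prob_Suc:
  "srw_prob (Suc k) (x :: int ^ 'd::finite) = step_mean (\<lambda>e. srw_prob k (x - e))"
proof -
  have "ennreal (srw_prob (Suc k) x) = (\<integral>\<^sup>+w. ennreal (of_bool (srw (Suc k) w = x)) \<partial>srw_law)"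
    unfolding srw_prob_eq by (intro nn_integral_cong) auto
  also have "\<dots> = (\<integral>\<^sup>+w. ennreal (step_mean (\<lambda>e. of_bool (srw (Suc k) (w(k := e)) = x))) \<partial>srw_law)"
    by (rule nn_integral_resample[OF borel_measurable_of_bool_srw]) simp
  also have "\<dots> = (\<integral>\<^sup>+w. (\<Sum>e\<in>unit_steps. ennreal (1 / card (unit_steps :: (int ^ 'd) set))
      * of_bool (srw k w = x - e)) \<partial>srw_law)"
  proof (intro nn_integral_cong)
    fix w :: "nat \<Rightarrow> int ^ 'd"
    let ?c = "1 / card (unit_steps :: (int ^ 'd) set)"
    have "step_mean (\<lambda>e. of_bool (srw (Suc k) (w(k := e)) = x)) =
        (\<Sum>e\<in>unit_steps. ?c * of_bool (srw k w = x - e))"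
      unfolding step_mean_def sum_divide_distrib by (intro sum.cong) (auto simp: algebra_simps)
    then have "ennreal (step_mean (\<lambda>e. of_bool (srw (Suc k) (w(k := e)) = x))) =
        (\<Sum>e\<in>unit_steps. ennreal (?c * of_bool (srw k w = x - e)))"
      by (subst sum_ennreal) auto
    also have "\<dots> = (\<Sum>e\<in>unit_steps. ennreal ?c * of_bool (srw k w = x - e))"
      by (intro sum.cong) auto
    finally show "ennreal (step_mean (\<lambda>e. of_bool (srw (Suc k) (w(k := e)) = x))) =
        (\<Sum>e\<in>unit_steps. ennreal ?c * of_bool (srw k w = x - e))" .
  qed
  also have "\<dots> = (\<Sum>e\<in>unit_steps. ennreal (1 / card (unit_steps :: (int ^ 'd) set))
      * ennreal (srw_prob k (x - e)))"
    unfolding srw_prob_eq by (simp only: nn_integral_sum nn_integral_cmult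
        borel_measurable_of_bool_srw
        borel_measurable_times_ennreal borel_measurable_const)
  also have "\<dots> = ennreal (step_mean (\<lambda>e. srw_prob k (x - e)))"
    by (simp add: step_mean_def sum_divide_distrib sum_ennreal srw_prob_def flip: ennreal_mult')
  finally show ?thesis
    by (subst (asm) ennreal_inj) (auto simp: srw_prob_def intro!: step_mean_nonneg)
qed

lemma green_eq_suminf: "green (x :: int ^ 'd::finite) = (\<Sum>k. ennreal (srw_prob k x))"
  unfolding green_def total_local_time_def srw_prob_eq
  by (rule nn_integral_suminf[OF borel_measurable_of_bool_srw])

text \<open>\<open>enn2real\<close> sends infinity to 0, so this is the Green kernel only where
  \<open>green\<close> is finite.\<close>

definition greenr :: "int ^ 'd \<Rightarrow> real" where
  "greenr x = enn2real (green x)"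

lemma greenr_nonneg [simp]: "0 \<le> greenr x"
  by (simp add: greenr_def)

text \<open>The term \<open>k = 0\<close> of the Green series is the indicator of the origin, and
  the recursion for \<open>srw_prob\<close> shifts the remaining terms by one step. Symmetry of the
  steps turns \<open>x - e\<close> into \<open>x + e\<close>.\<close>

lemma greenr_rec:
  fixes x :: "int ^ 'd::finite"
  assumes fin: "\<And>x::int ^ 'd. green x < \<infinity>"
  shows "greenr x = of_bool (x = 0) + step_mean (\<lambda>e. greenr (x + e))"
proof -
  have nn: "0 \<le> srw_prob k x" for k and x :: "int ^ 'd" by (simp add: srw_prob_def)
  have sm: "summable (\<lambda>k. srw_prob k x)" for x :: "int ^ 'd"
    using fin[of x] by (intro summable_suminf_not_top) (auto simp: nn green_eq_suminf)
  have g: "greenr x = (\<Sum>k. srw_prob k x)" for x :: "int ^ 'd"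
    unfolding greenr_def green_eq_suminf
    by (subst suminf_ennreal2) (auto simp: nn sm suminf_nonneg)
  have "greenr x = srw_prob 0 x + (\<Sum>k. srw_prob (Suc k) x)"
    unfolding g by (subst suminf_split_head[OF sm]) simp
  also have "(\<Sum>k. srw_prob (Suc k) x) = step_mean (\<lambda>e. greenr (x - e))"
    unfolding srw_prob_Suc step_mean_def g
    by (simp add: suminf_divide suminf_sum summable_sum sm)
  also have "\<dots> = step_mean (\<lambda>e. greenr (x + e))"
    using step_mean_uminus[of "\<lambda>e. greenr (x + e)"] by simp
  finally show ?thesis by (simp add: srw_prob_0)
qed

text \<open>
  If \<open>\<phi> = l + P \<phi>\<close> is the potential of \<open>l\<close>, this says that \<open>u = 1 + c \<phi>\<close> satisfies \<open>exp(\<theta> l) P u \<le>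
  u\<close>.
\<close>

lemma exp_mult_linear_le:
  fixes l \<phi> a \<theta> c :: real
  assumes "0 \<le> l" "l \<le> \<phi>" "\<phi> \<le> a" "0 \<le> \<theta>" "\<theta> * a < 1" and c: "c = \<theta> / (1 - \<theta> * a)"
  shows "exp (\<theta> * l) * (1 + c * (\<phi> - l)) \<le> 1 + c * \<phi>"
proof -
  have c0: "0 \<le> c" using assms by simp
  define u where "u = 1 + c * \<phi>"
  have u1: "1 \<le> u" using c0 assms by (simp add: u_def)
  have "c * (1 - \<theta> * a) = \<theta>" using assms by (simp add: c)
  \<comment> \<open>This fixed-point equation explains the choice of \<open>c\<close>: it gives
    \<open>\<theta> * u \<le> c\<close> as long as \<open>u\<close> is at most
    \<open>1 + c * a\<close>.\<close>
  then have "c = \<theta> * (1 + c * a)" by (simp add: algebra_simps)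
  moreover have "u \<le> 1 + c * a" using c0 assms(3) by (simp add: u_def mult_left_mono)
  ultimately have "\<theta> * u \<le> c" using \<open>0 \<le> \<theta>\<close> by (metis mult_left_mono)
  then have "\<theta> * l * u \<le> c * l" using \<open>0 \<le> l\<close> by (metis mult.assoc mult.commute mult_left_mono)
  then have "u - c * l \<le> u * (1 - \<theta> * l)" by (simp add: algebra_simps)
  also have "\<dots> \<le> u * exp (- (\<theta> * l))"
    using exp_ge_add_one_self[of "- (\<theta> * l)"] u1 by (intro mult_left_mono) auto
  finally have "exp (\<theta> * l) * (u - c * l) \<le> exp (\<theta> * l) * (u * exp (- (\<theta> * l)))"
    by (intro mult_left_mono) auto
  also have "\<dots> = u" by (simp add: exp_minus)
  finally show ?thesis by (simp add: u_def algebra_simps)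
qed

text \<open>Markov's inequality, with \<open>W\<close> allowed any values off the event.\<close>

lemma srw_prob_le_of_nn_integral:
  fixes W :: "(nat \<Rightarrow> int ^ 'd::finite) \<Rightarrow> real"
  assumes [measurable]: "W \<in> borel_measurable srw_law" "Measurable.pred srw_law Q"
    and b: "(\<integral>\<^sup>+w. ennreal (W w) \<partial>srw_law) \<le> ennreal b" "0 \<le> b"
    and t: "0 < t" "\<And>w. Q w \<Longrightarrow> t \<le> W w"
  shows "\<P>(w in srw_law. Q w) \<le> b / t"
proof -
  let ?A = "{w \<in> space srw_law. Q w}"
  have "?A \<in> sets srw_law" by measurable
  then have "ennreal t * emeasure srw_law ?A = (\<integral>\<^sup>+w. ennreal t * indicator ?A w \<partial>srw_law)"
    by (rule nn_integral_cmult_indicator[symmetric])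
  also have "\<dots> \<le> (\<integral>\<^sup>+w. ennreal (W w) \<partial>srw_law)"
    by (intro nn_integral_mono) (auto simp: indicator_def t ennreal_leI)
  also have "\<dots> \<le> ennreal b" by fact
  finally have "t * \<P>(w in srw_law. Q w) \<le> b"
    using t b by (simp add: srw.emeasure_eq_measure flip: ennreal_mult')
  then show ?thesis using t by (simp add: field_simps)
qed

section \<open>Potential theory of a square-summable Green kernel\<close>

locale green_l2 =
  fixes dim :: "'d::finite itself" and B :: real
  assumes green_finite: "green (x :: int ^ 'd) < \<infinity>"
    and sum_greenr_sq_le: "finite F \<Longrightarrow> (\<Sum>x\<in>F. (greenr (x :: int ^ 'd))\<^sup>2) \<le> B"
begin

abbreviation G :: "int ^ 'd \<Rightarrow> real" where "G \<equiv> greenr"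

lemma step_mean_green: "step_mean (\<lambda>e. G (x + e)) = G x - of_bool (x = 0)"
  using greenr_rec[OF green_finite, of x] by simp

lemma green_ge_of_bool: "of_bool (x = 0) \<le> G x"
  using greenr_rec[OF green_finite, of x] step_mean_nonneg[of "\<lambda>e. G (x + e)"] by simp

lemma green_0_ge_1: "1 \<le> G 0"
  using green_ge_of_bool[of 0] by simp

lemma green_0_le: "G 0 \<le> B"
proof -
  have "G 0 * 1 \<le> G 0 * G 0" using green_0_ge_1 by (intro mult_left_mono) auto
  then show ?thesis using sum_greenr_sq_le[of "{0}"] by (simp add: power2_eq_square)
qed

lemma B_pos: "0 < B"
  using green_0_le green_0_ge_1 by linarith

text \<open>The Green potential of \<open>G\<close> itself, that is, the mean of the total of
  \<open>G\<close> along a walk started at \<open>x\<close>.\<close>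

definition green_conv :: "int ^ 'd \<Rightarrow> real" where
  "green_conv x = (\<Sum>\<^sub>\<infinity>y. G y * G (x - y))"

text \<open>By \<open>2 a b \<le> a^2 + b^2\<close> the sum is at most the mean of two finite sums
  of squares of \<open>G\<close>, since \<open>y\<close> determines \<open>x - y\<close>
  injectively.\<close>

lemma sum_green_conv_le:
  assumes "finite F"
  shows "(\<Sum>y\<in>F. G y * G (x - y)) \<le> B"
proof -
  have "(\<Sum>y\<in>F. G y * G (x - y)) \<le> (\<Sum>y\<in>F. ((G y)\<^sup>2 + (G (x - y))\<^sup>2) / 2)"
  proof (intro sum_mono)
    fix y show "G y * G (x - y) \<le> ((G y)\<^sup>2 + (G (x - y))\<^sup>2) / 2"
      using sum_squares_bound[of "G y" "G (x - y)"] by simp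
  qed
  also have "\<dots> = ((\<Sum>y\<in>F. (G y)\<^sup>2) + (\<Sum>y\<in>(\<lambda>y. x - y) ` F. (G y)\<^sup>2)) / 2"
    by (subst sum.reindex) (auto simp: sum.distrib o_def inj_on_def simp flip: sum_divide_distrib)
  also have "\<dots> \<le> B"
    using sum_greenr_sq_le[OF assms] sum_greenr_sq_le[of "(\<lambda>y. x - y) ` F"] assms by simp
  finally show ?thesis .
qed

lemma summable_green_conv: "(\<lambda>y. G y * G (x - y)) summable_on UNIV"
  by (rule nonneg_bounded_partial_sums_imp_summable_on[where C = B])
    (auto simp: eventually_finite_subsets_at_top intro!: sum_green_conv_le exI[of _ "{}"])

lemma green_conv_nonneg: "0 \<le> green_conv x"
  unfolding green_conv_def by (intro infsum_nonneg) auto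

lemma green_conv_le: "green_conv x \<le> B"
  unfolding green_conv_def
  by (intro infsum_le_finite_sums summable_green_conv sum_green_conv_le) auto

text \<open>The average acts on the factor \<open>G (x - y)\<close> alone, and there it removes the
  indicator of \<open>y = x\<close>, whose total contribution is \<open>G x\<close>.\<close>

lemma step_mean_green_conv: "step_mean (\<lambda>e. green_conv (x + e)) = green_conv x - G x"
proof -
  have "((\<lambda>y. \<Sum>e\<in>I. G y * G (x + e - y)) has_sum (\<Sum>e\<in>I. green_conv (x + e))) UNIV"
    if "finite I" for I
    using that unfolding green_conv_def
    by induction (auto intro!: has_sum_add has_sum_infsum summable_green_conv)
  from this[OF finite_unit_steps]
  have "((\<lambda>y. (1 / card (unit_steps :: (int ^ 'd) set)) * (\<Sum>e\<in>unit_steps. G y * G (x + e - y)))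
      has_sum
      (1 / card (unit_steps :: (int ^ 'd) set)) * (\<Sum>e\<in>unit_steps. green_conv (x + e))) UNIV"
    by (rule has_sum_cmult_right)
  also have "(\<lambda>y. (1 / card (unit_steps :: (int ^ 'd) set)) * (\<Sum>e\<in>unit_steps. G y * G (x
      + e - y))) =
      (\<lambda>y. G y * step_mean (\<lambda>e. G (x - y + e)))"
    by (simp add: step_mean_def sum_distrib_left sum_divide_distrib algebra_simps)
  finally have 1: "((\<lambda>y. G y * step_mean (\<lambda>e. G (x - y + e))) has_sum step_mean (\<lambda>e. green_conv (x
      + e))) UNIV"
    by (simp add: step_mean_def)
  have "((\<lambda>y. G y * of_bool (x - y = 0)) has_sum G x) UNIV"
    by (rule has_sum_finite_neutralI[of "{x}"]) auto
  from has_sum_add[OF has_sum_infsum[OF summable_green_conv[of x]]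
      has_sum_cmult_right[OF this, of "-1"]]
  have "((\<lambda>y. G y * step_mean (\<lambda>e. G (x - y + e))) has_sum green_conv x - G x) UNIV"
    unfolding step_mean_green by (simp add: green_conv_def right_diff_distrib)
  from has_sum_unique[OF 1 this] show ?thesis .
qed

text \<open>Khas'minskii's argument: \<open>green_conv\<close> solves
  \<open>\<phi> = G + P \<phi>\<close> and is at most \<open>B\<close>, so multiplying by
  \<open>1 + c * green_conv\<close> turns the exponential into a supermartingale. Its initial value
  is at most \<open>1 + c * B = 1 / (1 - \<theta> * B)\<close>.\<close>

lemma nn_integral_exp_sum_green_le:
  assumes "0 \<le> \<theta>" "\<theta> * B < 1"
  shows "(\<integral>\<^sup>+w. ennreal (exp (\<theta> * (\<Sum>i<k. G (srw i w)))) \<partial>srw_law) \<le> ennreal (1 / (1 - \<theta> * B))"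
proof -
  define c where "c = \<theta> / (1 - \<theta> * B)"
  have c0: "0 \<le> c" using assms by (simp add: c_def)
  define W where "W k w = exp (\<theta> * (\<Sum>i<k. G (srw i w))) * (1 + c * green_conv (srw k w))" for k w
  have nn: "0 \<le> c * green_conv x" for x
    using c0 green_conv_nonneg by simp
  have "(\<integral>\<^sup>+w. ennreal (exp (\<theta> * (\<Sum>i<k. G (srw i w)))) \<partial>srw_law) \<le> (\<integral>\<^sup>+w. ennreal (W k w) \<partial>srw_law)"
    using nn by (intro nn_integral_mono ennreal_leI) (simp add: W_def)
  also have "\<dots> \<le> ennreal (1 / (1 - \<theta> * B) * 1 ^ k)"
  proof (rule nn_integral_supermartingale)
    fix n and w w' :: "nat \<Rightarrow> int ^ 'd"
    assume "\<And>i. i < n \<Longrightarrow> w i = w' i"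
    then have "srw i w = srw i w'" if "i \<le> n" for i
      using that by (intro srw_cong) auto
    then show "W n w = W n w'" by (simp add: W_def)
  next
    fix n and w :: "nat \<Rightarrow> int ^ 'd"
    show "0 \<le> W n w" using nn[of "srw n w"] by (simp add: W_def)
  next
    fix w :: "nat \<Rightarrow> int ^ 'd"
    have "c * green_conv 0 \<le> c * B" using c0 green_conv_le by (intro mult_left_mono)
    moreover have "1 + c * B = 1 / (1 - \<theta> * B)" using assms by (simp add: c_def field_simps)
    ultimately show "W 0 w \<le> 1 / (1 - \<theta> * B)" by (simp add: W_def)
  next
    fix n and w :: "nat \<Rightarrow> int ^ 'd"
    let ?E = "exp (\<theta> * (\<Sum>i<n. G (srw i w)))"
    have eq: "W (Suc n) (w(n := e)) =
        ?E * exp (\<theta> * G (srw n w)) * (1 + c * green_conv (srw n w + e))" for e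
      by (simp add: W_def ring_distribs exp_add)
    have "step_mean (\<lambda>e. W (Suc n) (w(n := e))) =
        ?E * (exp (\<theta> * G (srw n w)) * (1 + c * (green_conv (srw n w) - G (srw n w))))"
      unfolding eq by (simp add: step_mean_cmult step_mean_add step_mean_green_conv)
    also have "\<dots> \<le> ?E * (1 + c * green_conv (srw n w))"
    proof (intro mult_left_mono exp_mult_linear_le[where a = B])
      show "G (srw n w) \<le> green_conv (srw n w)"
        using step_mean_green_conv[of "srw n w"]
          step_mean_nonneg[of "\<lambda>e. green_conv (srw n w + e)"] green_conv_nonneg by simp
    qed (use assms c_def green_conv_le in auto)
    finally show "step_mean (\<lambda>e. W (Suc n) (w(n := e))) \<le> 1 * W n w"
      by (simp add: W_def)
  qed simp
  finally show ?thesis by simp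
qed

text \<open>Markov's inequality at \<open>\<theta> = 1 / (2 * B)\<close>, half the critical value,
  where the exponential moment is at most 2.\<close>

lemma prob_sum_green_gt_le:
  "\<P>(w in srw_law. a < (\<Sum>i\<le>k. G (srw i w))) \<le> 2 * exp (- a / (2 * B))"
proof -
  have B: "1 / (2 * B) * B = 1 / 2" using B_pos by simp
  have "(\<integral>\<^sup>+w. ennreal (exp (1 / (2 * B) * (\<Sum>i<Suc k. G (srw i w)))) \<partial>srw_law)
      \<le> ennreal (1 / (1 - 1 / (2 * B) * B))"
    using B_pos by (intro nn_integral_exp_sum_green_le) auto
  then have "(\<integral>\<^sup>+w. ennreal (exp (1 / (2 * B) * (\<Sum>i\<le>k. G (srw i w)))) \<partial>srw_law) \<le> ennreal 2"
    unfolding B lessThan_Suc_atMost by simp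
  then have "\<P>(w in srw_law. a < (\<Sum>i\<le>k. G (srw i w))) \<le> 2 / exp (a / (2 * B))"
    using B_pos by (intro srw_prob_le_of_nn_integral) (auto simp: divide_right_mono)
  then show ?thesis by (simp add: exp_minus field_simps)
qed

text \<open>Reversing the first \<open>k\<close> increments preserves the law and turns
  \<open>S_i\<close> into \<open>S_k - S_(k-i)\<close>. The potential seen from the current position
  thus becomes an additive functional of the walk.\<close>

lemma prob_sum_green_reversed:
  "\<P>(w in srw_law. a < (\<Sum>i\<le>k. G (srw k w - srw i w))) = \<P>(w in srw_law. a < (\<Sum>i\<le>k. G (srw i w)))"
proof -
  define t where "t i = (if i < k then k - 1 - i else i)" for i
  let ?S = "srw_law :: (nat \<Rightarrow> int ^ 'd) measure"
  let ?r = "\<lambda>(w :: nat \<Rightarrow> int ^ 'd) i. w (t i)"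
  \<comment> \<open>The index map \<open>t\<close> is an involution: it reverses the indices below
    \<open>k\<close> and fixes the others.\<close>
  have "inj t" by (rule inj_on_inverseI[of _ t]) (auto simp: t_def)
  then have eq: "distr ?S ?S ?r = ?S"
    using distr_PiM_reindex[of UNIV "\<lambda>_. measure_pmf (pmf_of_set (unit_steps :: (int ^ 'd) set))"
        t UNIV]
    by (simp add: srw_law_def prob_space_measure_pmf restrict_UNIV)
  have r: "?r \<in> ?S \<rightarrow>\<^sub>M ?S"
    unfolding srw_law_def
    by (rule measurable_PiM_single') (auto simp: space_PiM measurable_coord[unfolded srw_law_def])
  have rev: "srw i (?r w) = srw k w - srw (k - i) w" if "i \<le> k" for i w
  proof -
    have "srw i (?r w) = (\<Sum>j<i. w (k - 1 - j))"
      using that by (auto simp: srw_def t_def intro!: sum.cong)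
    also have "\<dots> = (\<Sum>j\<in>{k - i..<k}. w j)"
      using that by (intro sum.reindex_bij_witness[of _ "\<lambda>j. k - 1 - j" "\<lambda>j. k - 1 - j"]) auto
    also have "\<dots> = srw k w - srw (k - i) w"
      unfolding srw_def lessThan_atLeast0
      using sum.atLeastLessThan_concat[of 0 "k - i" k w] by (simp add: algebra_simps)
    finally show ?thesis .
  qed
  have sum_rev: "(\<Sum>i\<le>k. G (srw i (?r w))) = (\<Sum>i\<le>k. G (srw k w - srw i w))" for w
    by (rule sum.reindex_bij_witness[of _ "\<lambda>i. k - i" "\<lambda>i. k - i"]) (auto simp: rev)
  have ev: "{w \<in> space ?S. a < (\<Sum>i\<le>k. G (srw i w))} \<in> sets ?S" by measurable
  have "\<P>(w in ?S. a < (\<Sum>i\<le>k. G (srw i w))) =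
      measure (distr ?S ?S ?r) {w \<in> space ?S. a < (\<Sum>i\<le>k. G (srw i w))}"
    by (simp add: eq)
  also have "\<dots> = \<P>(w in ?S. a < (\<Sum>i\<le>k. G (srw k w - srw i w)))"
    by (subst measure_distr[OF r ev]) (simp add: vimage_def sum_rev)
  finally show ?thesis ..
qed

end

section \<open>Self-intersections and the sum of squared local times\<close>

definition hits :: "nat \<Rightarrow> int ^ 'd \<Rightarrow> (nat \<Rightarrow> int ^ 'd) \<Rightarrow> real" where
  "hits n x w = (\<Sum>i\<le>n. of_bool (srw i w = x))"

text \<open>This is \<open>V_n\<close>: the pairs are grouped by their later time
  \<open>Suc j\<close>.\<close>

definition return_pairs :: "nat \<Rightarrow> (nat \<Rightarrow> int ^ 'd) \<Rightarrow> real" where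
  "return_pairs n w = (\<Sum>j<n. hits j (srw (Suc j) w) w)"

lemma hits_nonneg: "0 \<le> hits n x w"
  by (simp add: hits_def sum_nonneg)

lemma return_pairs_cong:
  assumes "\<And>i. i \<le> n \<Longrightarrow> srw i w = srw i w'"
  shows "return_pairs n w = return_pairs n w'"
  unfolding return_pairs_def hits_def by (intro sum.cong) (auto simp: assms)

lemma real_local_time: "real (local_time n x w) = hits n x w"
  by (simp add: local_time_def hits_def atLeast0AtMost del: sum_of_bool_eq)

text \<open>Induction on time: a visit to a site already hit \<open>m\<close> times raises the
  square by \<open>2 * m + 1\<close>, where \<open>m\<close> is the number of new pairs. The finite
  set \<open>R\<close> of sites visited up to time \<open>n\<close> stays fixed throughout.\<close>

lemma infsum_local_time_sq:
  fixes w :: "nat \<Rightarrow> int ^ 'd::finite"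
  shows "(\<Sum>\<^sub>\<infinity>x. (real (local_time n x w))\<^sup>2) = real n + 1 + 2 * return_pairs n w"
proof -
  define R where "R = (\<lambda>i. srw i w) ` {..n}"
  have fin: "finite R" by (simp add: R_def)
  have sum_R: "(\<Sum>x\<in>R. f x * of_bool (srw k w = x)) = f (srw k w)" if "k \<le> n"
      for f :: "int ^ 'd \<Rightarrow> real" and k
  proof -
    have "(\<Sum>x\<in>R. f x * of_bool (srw k w = x)) = (\<Sum>x\<in>R. if srw k w = x then f x else 0)"
      by (intro sum.cong) auto
    also have "\<dots> = f (srw k w)" using that by (subst sum.delta'[OF fin]) (auto simp: R_def)
    finally show ?thesis .
  qed
  have "(\<Sum>\<^sub>\<infinity>x. (real (local_time n x w))\<^sup>2) = (\<Sum>\<^sub>\<infinity>x\<in>R. (hits n x w)\<^sup>2)"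
    unfolding real_local_time
    by (rule infsum_cong_neutral) (auto simp: R_def hits_def)
  also have "\<dots> = (\<Sum>x\<in>R. (hits n x w)\<^sup>2)" by (simp add: fin)
  also have "(\<Sum>x\<in>R. (hits k x w)\<^sup>2) = real k + 1 + 2 * return_pairs k w" if "k \<le> n" for k
    using that
  proof (induction k)
    case 0
    then show ?case using sum_R[of 0 "\<lambda>_. 1"]
      by (simp add: hits_def return_pairs_def power2_eq_square of_bool_conj[symmetric] del: sum_of_bool_eq)
  next
    case (Suc k)
    let ?z = "srw (Suc k) w"
    have "(\<Sum>x\<in>R. (hits (Suc k) x w)\<^sup>2) =
        (\<Sum>x\<in>R. (hits k x w)\<^sup>2 + (2 * hits k x w + 1) * of_bool (?z = x))"
      by (intro sum.cong) (auto simp: hits_def power2_eq_square algebra_simps)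
    also have "\<dots> = real (Suc k) + 1 + 2 * return_pairs (Suc k) w"
      using Suc sum_R[of "Suc k" "\<lambda>x. 2 * hits k x w + 1"]
      by (simp add: sum.distrib return_pairs_def)
    finally show ?case .
  qed
  finally show ?thesis by simp
qed

lemma measurable_return_pairs [measurable]:
  "return_pairs n \<in> borel_measurable (srw_law :: (nat \<Rightarrow> int ^ 'd::finite) measure)"
  by (rule measurable_prefix[of n]) (auto intro!: return_pairs_cong srw_cong)

section \<open>The upper bound\<close>

context green_l2
begin

text \<open>Markov's inequality for \<open>W\<close>, whose mean grows by a factor of at most
  \<open>r\<close> per step. The indicator of \<open>good\<close> supplies the bound
  \<open>a\<close> on the potential at each step; as \<open>good\<close> can only be lost in time,
  the truncation never increases \<open>W\<close>.\<close>

lemma prob_return_pairs_ge_le: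
  assumes \<theta>: "0 < \<theta>" "\<theta> * a < 1"
  shows "\<P>(w in srw_law. t \<le> return_pairs n w \<and> (\<forall>j\<le>n. (\<Sum>i\<le>j. G (srw j w - srw i w)) \<le> a))
    \<le> exp (\<theta> / (1 - \<theta> * a) * (G 0 - 1) * (real n + 1) - \<theta> * t)"
proof -
  define c where "c = \<theta> / (1 - \<theta> * a)"
  define r where "r = 1 + c * (G 0 - 1)"
  define \<phi> where "\<phi> n w z = (\<Sum>i\<le>n. G (z - srw i w))" for n w z
  define good where "good n w \<longleftrightarrow> (\<forall>j\<le>n. \<phi> j w (srw j w) \<le> a)" for n w
  \<comment> \<open>At the current position \<open>\<phi>\<close> minus \<open>hits\<close> is
    \<open>\<psi>_n\<close>, the expected number of future visits to the sites counted so
    far.\<close>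
  define W where "W n w = of_bool (good n w) * (exp (\<theta> * return_pairs n w) *
      (1 + c * (\<phi> n w (srw n w) - hits n (srw n w) w)))" for n w
  have c0: "0 \<le> c" using \<theta> by (simp add: c_def)
  have r1: "1 \<le> r" using c0 green_0_ge_1 by (simp add: r_def)
  have hits_le: "hits n z w \<le> \<phi> n w z" for n z w
    unfolding hits_def \<phi>_def
  proof (rule sum_mono)
    fix i show "of_bool (srw i w = z) \<le> G (z - srw i w)"
      using green_ge_of_bool[of "z - srw i w"] by (auto simp: of_bool_def split: if_splits)
  qed
  have W_dep: "W n w = W n w'" if "\<And>i. i < n \<Longrightarrow> w i = w' i" for n w w'
  proof -
    have S: "srw i w = srw i w'" if "i \<le> n" for i
      using that \<open>\<And>i. i < n \<Longrightarrow> w i = w' i\<close> by (intro srw_cong) auto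
    have \<phi>: "\<phi> j w z = \<phi> j w' z" if "j \<le> n" for j z
      unfolding \<phi>_def using that by (intro sum.cong) (auto simp: S)
    have "hits n z w = hits n z w'" for z
      unfolding hits_def by (intro sum.cong) (auto simp: S)
    moreover have "good n w = good n w'" by (auto simp: good_def \<phi> S)
    ultimately show ?thesis
      using return_pairs_cong[of n w w'] by (simp add: W_def S \<phi>)
  qed
  have W_nonneg: "0 \<le> W n w" for n w
    using c0 hits_le by (simp add: W_def)
  have step: "step_mean (\<lambda>e. W (Suc n) (w(n := e))) \<le> r * W n w" for n w
  proof -
    let ?E = "of_bool (good n w) * exp (\<theta> * return_pairs n w)"
    have \<phi>_upd: "\<phi> j (w(n := e)) = \<phi> j w" if "j \<le> n" for j e
      unfolding \<phi>_def using that by (intro ext sum.cong) auto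
    have hits_upd: "hits n z (w(n := e)) = hits n z w" for z e
      unfolding hits_def by (intro sum.cong) auto
    have "return_pairs n (w(n := e)) = return_pairs n w" for e
      by (intro return_pairs_cong) simp
    moreover have "return_pairs (Suc n) v = return_pairs n v + hits n (srw (Suc n) v) v"
        for v :: "nat \<Rightarrow> int ^ 'd"
      by (simp add: return_pairs_def)
    ultimately have return_pairs_Suc:
      "return_pairs (Suc n) (w(n := e)) = return_pairs n w + hits n (srw n w + e) w" for e
      by (simp add: hits_upd)
    have \<phi>_Suc: "\<phi> (Suc n) (w(n := e)) (srw n w + e) = \<phi> n w (srw n w + e) + G 0" for e
      using \<phi>_upd[of n e] by (simp add: \<phi>_def)
    have hits_Suc: "hits (Suc n) (srw n w + e) (w(n := e)) = hits n (srw n w + e) w + 1" for e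
      using hits_upd[of "srw n w + e" e] by (simp add: hits_def del: sum_of_bool_eq)
    have good_Suc: "good (Suc n) (w(n := e)) \<longleftrightarrow> good n w \<and> \<phi> n w (srw n w + e) + G 0 \<le> a" for e
      unfolding good_def by (auto simp: le_Suc_eq \<phi>_Suc \<phi>_upd)
    have "W (Suc n) (w(n := e)) \<le> ?E * (r * (1 + c * \<phi> n w (srw n w + e)))" for e
    proof (cases "good (Suc n) (w(n := e))")
      case True
      let ?z = "srw n w + e"
      let ?p = "1 + c * (\<phi> n w ?z - hits n ?z w)"
      have bound: "\<phi> n w ?z \<le> a" using True green_0_ge_1 by (simp add: good_Suc)
      \<comment> \<open>The newly visited site adds \<open>G 0\<close> to the potential and 1 to
        \<open>hits\<close>. As \<open>?p\<close> is at least 1, the resulting gain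
        \<open>c * (G 0 - 1)\<close> is absorbed by the factor \<open>r\<close>.\<close>
      have "c * (G 0 - 1) * 1 \<le> c * (G 0 - 1) * ?p"
        using c0 green_0_ge_1 hits_le by (intro mult_left_mono) auto
      then have "?p + c * (G 0 - 1) \<le> r * ?p" by (simp add: r_def algebra_simps)
      then have "exp (\<theta> * hits n ?z w) * (?p + c * (G 0 - 1)) \<le> r * (exp (\<theta> * hits n ?z w) * ?p)"
        by simp
      also have "\<dots> \<le> r * (1 + c * \<phi> n w ?z)"
        using r1 \<theta> bound
        by (intro mult_left_mono exp_mult_linear_le[where a = a])
            (auto simp: hits_nonneg hits_le c_def)
      finally have "?E * (exp (\<theta> * hits n ?z w) * (?p + c * (G 0 - 1))) \<le> ?E * (r * (1 + c
          * \<phi> n w ?z))"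
        by (intro mult_left_mono) auto
      moreover have "W (Suc n) (w(n := e)) = ?E * (exp (\<theta> * hits n ?z w) * (?p + c * (G 0 - 1)))"
        using True
        by (simp add: W_def good_Suc \<phi>_Suc hits_Suc return_pairs_Suc ring_distribs exp_add)
      ultimately show ?thesis by simp
    next
      case False
      have "0 \<le> \<phi> n w z" for z by (simp add: \<phi>_def sum_nonneg)
      then show ?thesis using False c0 r1 by (simp add: W_def)
    qed
    then have "step_mean (\<lambda>e. W (Suc n) (w(n := e))) \<le>
        step_mean (\<lambda>e. ?E * (r * (1 + c * \<phi> n w (srw n w + e))))"
      by (rule step_mean_mono)
    also have "\<dots> = ?E * (r * (1 + c * step_mean (\<lambda>e. \<phi> n w (srw n w + e))))"
      by (simp only: step_mean_cmult step_mean_add step_mean_const)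
    \<comment> \<open>Averaging the potential over the next step removes exactly the visits to the
      current position, which restores the last factor of \<open>W n\<close>.\<close>
    also have "step_mean (\<lambda>e. \<phi> n w (srw n w + e)) = \<phi> n w (srw n w) - hits n (srw n w) w"
    proof -
      have "step_mean (\<lambda>e. \<phi> n w (srw n w + e)) = (\<Sum>i\<le>n. step_mean (\<lambda>e. G (srw n w - srw i w + e)))"
        unfolding \<phi>_def step_mean_sum by (simp add: algebra_simps)
      also have "\<dots> = (\<Sum>i\<le>n. G (srw n w - srw i w) - of_bool (srw i w = srw n w))"
        unfolding step_mean_green by (intro sum.cong) auto
      finally show ?thesis by (simp add: \<phi>_def hits_def sum_subtractf del: sum_of_bool_eq)
    qed
    also have "?E * (r * (1 + c * (\<phi> n w (srw n w) - hits n (srw n w) w))) = r * W n w"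
      by (simp only: W_def mult_ac)
    finally show ?thesis .
  qed
  \<comment> \<open>At time 0 the potential is \<open>G 0\<close> and \<open>hits\<close> is 1, so
    the initial value already costs one factor \<open>r\<close>; hence the exponent
    \<open>n + 1\<close> below.\<close>
  have W_0: "W 0 w \<le> r" for w
    using r1 by (simp add: W_def \<phi>_def hits_def return_pairs_def r_def)
  have int: "(\<integral>\<^sup>+w. ennreal (W n w) \<partial>srw_law) \<le> ennreal (r * r ^ n)"
    by (rule nn_integral_supermartingale[OF W_dep W_nonneg _ W_0 step]) (use r1 in auto)
  have W_meas: "W n \<in> borel_measurable srw_law"
    by (rule measurable_prefix[OF W_dep]) auto
  have "\<P>(w in srw_law. t \<le> return_pairs n w \<and> good n w) \<le> r * r ^ n / exp (\<theta> * t)"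
  proof (rule srw_prob_le_of_nn_integral[OF W_meas _ int])
    show "Measurable.pred srw_law (\<lambda>w. t \<le> return_pairs n w \<and> good n w)"
      unfolding good_def \<phi>_def by measurable
    fix w assume *: "t \<le> return_pairs n w \<and> good n w"
    have "exp (\<theta> * t) * 1 \<le> exp (\<theta> * return_pairs n w) * (1 + c
        * (\<phi> n w (srw n w) - hits n (srw n w) w))"
      using * \<theta> c0 hits_le by (intro mult_mono) auto
    then show "exp (\<theta> * t) \<le> W n w" using * by (simp add: W_def)
  qed (use r1 in auto)
  also have "r * r ^ n = r ^ (n + 1)" by simp
  also have "\<dots> / exp (\<theta> * t) \<le> exp (c * (G 0 - 1)) ^ (n + 1) / exp (\<theta> * t)"
    using r1 by (intro divide_right_mono power_mono) (auto simp: r_def)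
  also have "\<dots> = exp (c * (G 0 - 1) * (real n + 1) - \<theta> * t)"
    unfolding exp_of_nat_mult[symmetric] exp_diff by (simp add: mult_ac add_ac)
  finally show ?thesis by (simp add: c_def good_def \<phi>_def)
qed

end

context green_l2
begin

text \<open>Here \<open>a = sqrt n\<close> and \<open>\<theta> = s / sqrt n\<close>, so that
  \<open>\<theta> * a = s\<close>. The second term is a union bound over the \<open>n + 1\<close>
  times at which the potential may exceed \<open>sqrt n\<close>.\<close>

lemma prob_return_pairs_ge_le_exp_sqrt:
  assumes "0 < n" "0 < s" "s < 1"
  shows "\<P>(w in (srw_law :: (nat \<Rightarrow> int ^ 'd) measure). t \<le> return_pairs n w) \<le>
    exp (s / sqrt n / (1 - s) * (G 0 - 1) * (real n + 1) - s / sqrt n * t) +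
    2 * (real n + 1) * exp (- sqrt n / (2 * B))"
proof -
  let ?S = "srw_law :: (nat \<Rightarrow> int ^ 'd) measure"
  let ?bad = "\<lambda>j w. sqrt n < (\<Sum>i\<le>j. G (srw j w - srw i w))"
  let ?good = "\<lambda>w. t \<le> return_pairs n w \<and> (\<forall>j\<le>n. (\<Sum>i\<le>j. G (srw j w - srw i w)) \<le> sqrt n)"
  have [measurable]: "{w. ?good w} \<in> sets ?S" "{w. ?bad j w} \<in> sets ?S" for j
  proof -
    have "{w \<in> space ?S. ?good w} \<in> sets ?S" by measurable
    then show "{w. ?good w} \<in> sets ?S" by simp
    have "{w \<in> space ?S. ?bad j w} \<in> sets ?S" by measurable
    then show "{w. ?bad j w} \<in> sets ?S" by simp
  qed
  have "{w. t \<le> return_pairs n w} \<subseteq> {w. ?good w} \<union> (\<Union>j\<in>{..n}. {w. ?bad j w})"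
    by (auto simp: not_le)
  then have "\<P>(w in ?S. t \<le> return_pairs n w)
      \<le> measure ?S ({w. ?good w} \<union> (\<Union>j\<in>{..n}. {w. ?bad j w}))"
    by (simp add: srw.finite_measure_mono)
  also have "\<dots> \<le> measure ?S {w. ?good w} + measure ?S (\<Union>j\<in>{..n}. {w. ?bad j w})"
    by (rule measure_Un_le) auto
  also have "measure ?S {w. ?good w} \<le> exp (s / sqrt n / (1 - s) * (G 0 - 1) * (real n
      + 1) - s / sqrt n * t)"
    using prob_return_pairs_ge_le[of "s / sqrt n" "sqrt n" t n] assms by simp
  also have "measure ?S (\<Union>j\<in>{..n}. {w. ?bad j w}) \<le> (\<Sum>j\<le>n. measure ?S {w. ?bad j w})"
    by (rule measure_UNION_le) auto
  also have "\<dots> \<le> (\<Sum>j\<le>n. 2 * exp (- sqrt n / (2 * B)))"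
    using prob_sum_green_gt_le[of "sqrt n"] by (intro sum_mono)
        (simp add: prob_sum_green_reversed[simplified])
  also have "\<dots> = 2 * (real n + 1) * exp (- sqrt n / (2 * B))" by simp
  finally show ?thesis by simp
qed

lemma eventually_prob_local_time_sq_le:
  assumes "1 + 2 * B < y"
  shows "\<exists>c>0. \<forall>\<^sub>F n in sequentially.
    \<P>(w in (srw_law :: (nat \<Rightarrow> int ^ 'd) measure).
      (\<Sum>\<^sub>\<infinity>x. (real (local_time n x w))\<^sup>2) \<ge> real n * y) \<le> exp (- c * sqrt (real n))"
proof -
  define g where "g = G 0 - 1"
  define y' where "y' = (y - 1) / 2"
  \<comment> \<open>With this choice \<open>1 - s\<close> is the midpoint of \<open>g / y'\<close>
    and 1, which makes \<open>h = g / (1 - s)\<close> smaller than \<open>y'\<close>.\<close>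
  define s where "s = (y' - g) / (2 * y')"
  have g: "0 \<le> g" "g < y'" using green_0_ge_1 green_0_le assms by (auto simp: g_def y'_def)
  then have s: "0 < s" "s < 1" by (auto simp: s_def field_simps)
  define h where "h = g / (1 - s)"
  have "h < y'"
  proof -
    have "1 - s = (y' + g) / (2 * y')" using g by (simp add: s_def field_simps)
    then have "h = g * (2 * y') / (y' + g)" by (simp add: h_def)
    also have "\<dots> < y'" using g by (simp add: divide_less_eq algebra_simps)
    finally show ?thesis .
  qed
  define d where "d = s * (y' - h)"
  have d: "0 < d" using s \<open>h < y'\<close> by (simp add: d_def)
  \<comment> \<open>The bounded remainder of the exponent: \<open>s * h\<close> stems from the extra
    step in \<open>n + 1\<close>, and \<open>s / 2\<close> from the \<open>- 1 / 2\<close> in the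
    threshold \<open>t\<close>.\<close>
  define K where "K = s * h + s / 2"
  have K: "0 \<le> K" using s g by (simp add: K_def h_def)
  define b where "b = 1 / (2 * B)"
  have b: "0 < b" using B_pos by (simp add: b_def)
  \<comment> \<open>Half of the smaller rate; the decay left over absorbs \<open>exp K\<close> and
    the factor \<open>2 * (n + 1)\<close>.\<close>
  define c where "c = min d b / 2"
  have c: "0 < c" "0 < d - c" "0 < b - c" using d b by (auto simp: c_def)
  have lim: "(\<lambda>n. exp (K - D * sqrt (real n)) + 2 * (real n + 1) * exp (- E * sqrt (real n))) \<longlonglongrightarrow> 0"
    if "0 < D" "0 < E" for D E
  proof -
    have "(\<lambda>n. exp K * exp (- (D * sqrt (real n)))) \<longlonglongrightarrow> 0"
      "(\<lambda>n. 2 * (real n + 1) * exp (- (E * sqrt (real n)))) \<longlonglongrightarrow> 0"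
      using that by real_asymp+
    from tendsto_add[OF this] show ?thesis by (simp add: exp_diff exp_minus divide_inverse)
  qed
  have "\<forall>\<^sub>F n in sequentially. exp (K - (d - c) * sqrt (real n)) + 2 * (real n + 1)
      * exp (- (b - c) * sqrt (real n)) < 1"
    using order_tendstoD(2)[OF lim[OF c(2,3)], of 1] by simp
  then have "\<forall>\<^sub>F n in sequentially.
    \<P>(w in (srw_law :: (nat \<Rightarrow> int ^ 'd) measure).
      (\<Sum>\<^sub>\<infinity>x. (real (local_time n x w))\<^sup>2) \<ge> real n * y) \<le> exp (- c * sqrt (real n))"
    using eventually_gt_at_top[of 0]
  proof eventually_elim
    case (elim n)
    \<comment> \<open>The value that \<open>V_n\<close> must reach for \<open>n + 1 + 2 V_n\<close>
      to be at least \<open>n y\<close>.\<close>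
    define t where "t = (real n * y - real n - 1) / 2"
    define q where "q = sqrt (real n)"
    have q: "1 \<le> q" "real n = q * q" using elim by (auto simp: q_def)
    have t: "t = q * q * y' - 1 / 2"
      unfolding t_def y'_def q(2) by (simp add: field_simps)
    have "s / q / (1 - s) * g * (real n + 1) - s / q * t = s / q * (h * (q * q + 1) - t)"
      unfolding q(2) h_def by (simp add: right_diff_distrib)
    also have "\<dots> = s / q * (q * q * (h - y') + (h + 1 / 2))"
      unfolding t by (simp add: algebra_simps)
    also have "\<dots> = K / q - d * q"
      using q(1) by (simp add: K_def d_def field_simps)
    also have "K / q \<le> K / 1" using q(1) K by (intro divide_left_mono) auto
    finally have K_bound: "s / q / (1 - s) * g * (real n + 1) - s / q * t \<le> K - d * q" by simp
    have "\<P>(w in (srw_law :: (nat \<Rightarrow> int ^ 'd) measure). t \<le> return_pairs n w) \<le>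
        exp (s / q / (1 - s) * g * (real n + 1) - s / q * t) + 2 * (real n + 1) * exp (- q / (2
            * B))"
      unfolding q_def g_def using elim s by (intro prob_return_pairs_ge_le_exp_sqrt) auto
    also have "\<dots> \<le> exp (K - d * q) + 2 * (real n + 1) * exp (- b * q)"
      using K_bound by (simp add: b_def)
    also have "\<dots> = exp (- c * q) * (exp (K - (d - c) * q) + 2 * (real n + 1) * exp (- (b - c) * q))"
      by (simp add: ring_distribs exp_add[symmetric] mult.left_commute[of "exp _"])
    also have "\<dots> \<le> exp (- c * q) * 1"
      using elim by (intro mult_left_mono) (auto simp: q_def)
    finally show ?case
      by (simp add: infsum_local_time_sq t_def q_def field_simps)
  qed
  then show ?thesis using c by blast
qed

end

section \<open>The lower bound\<close>

lemma prob_prefix_eq: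
  fixes v :: "nat \<Rightarrow> int ^ 'd::finite"
  assumes "\<And>i. i < m \<Longrightarrow> v i \<in> unit_steps"
  shows "\<P>(w in srw_law. \<forall>i<m. w i = v i) = (1 / card (unit_steps :: (int ^ 'd) set)) ^ m"
proof -
  let ?M = "\<lambda>_ :: nat. measure_pmf (pmf_of_set (unit_steps :: (int ^ 'd) set))"
  interpret product_prob_space ?M UNIV
    by unfold_locales
  have "restrict w {..<m} \<in> (\<Pi>\<^sub>E i\<in>{..<m}. {v i}) \<longleftrightarrow> (\<forall>i<m. w i = v i)" for w
    unfolding PiE_iff by (simp add: Ball_def)
  then have "{w. \<forall>i<m. w i = v i} = prod_emb UNIV ?M {..<m} (\<Pi>\<^sub>E i\<in>{..<m}. {v i})"
    by (simp add: prod_emb_def space_PiM vimage_def)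
  then have "\<P>(w in srw_law. \<forall>i<m. w i = v i) =
      measure (Pi\<^sub>M UNIV ?M) (prod_emb UNIV ?M {..<m} (\<Pi>\<^sub>E i\<in>{..<m}. {v i}))"
    unfolding srw_law_def by (simp add: space_PiM)
  also have "\<dots> = (\<Prod>i<m. measure (?M i) {v i})"
    by (rule measure_PiM_emb) auto
  also have "\<dots> = (\<Prod>i<m. 1 / card (unit_steps :: (int ^ 'd) set))"
    using assms by (intro prod.cong) (auto simp: measure_pmf_single)
  finally show ?thesis by simp
qed

text \<open>A walk alternating between the origin and one neighbour for \<open>2 * q\<close> steps
  is at the origin at \<open>q + 1\<close> times, so the single site 0 contributes enough. Each
  prescribed step costs a factor \<open>1 / card unit_steps\<close>.\<close>

lemma prob_local_time_sq_ge:
  assumes "2 * q \<le> n"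
  shows "(1 / card (unit_steps :: (int ^ 'd) set)) ^ (2 * q) \<le>
    \<P>(w in (srw_law :: (nat \<Rightarrow> int ^ 'd::finite) measure).
      (real q)\<^sup>2 \<le> (\<Sum>\<^sub>\<infinity>x. (real (local_time n x w))\<^sup>2))"
proof -
  let ?S = "srw_law :: (nat \<Rightarrow> int ^ 'd) measure"
  define e :: "int ^ 'd" where "e = axis undefined 1"
  define v where "v i = (if even i then e else - e)" for i :: nat
  have v: "v i \<in> unit_steps" for i by (auto simp: v_def e_def unit_steps_def)
  have "(real q)\<^sup>2 \<le> (\<Sum>\<^sub>\<infinity>x. (real (local_time n x w))\<^sup>2)" if w: "\<forall>i<2 * q. w i = v i" for w
  proof -
    have ret: "srw (2 * i) w = 0" if "i \<le> q" for i
    proof -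
      have "srw (2 * i) w = srw (2 * i) v" using that w by (intro srw_cong) auto
      also have "\<dots> = 0" by (induction i) (auto simp: srw_def v_def)
      finally show ?thesis .
    qed
    have "real q \<le> card ((\<lambda>i. 2 * i) ` {..q})"
      by (subst card_image) (auto simp: inj_on_def)
    also have "\<dots> \<le> card {k \<in> {0..n}. srw k w = 0}"
      using assms ret by (intro of_nat_mono card_mono) auto
    also have "\<dots> = real (local_time n 0 w)"
      by (simp add: local_time_def Int_def)
    finally have "(real q)\<^sup>2 \<le> (real (local_time n 0 w))\<^sup>2" by simp
    also have "\<dots> = (\<Sum>\<^sub>\<infinity>x\<in>{0}. (real (local_time n x w))\<^sup>2)" by simp
    also have "\<dots> \<le> (\<Sum>\<^sub>\<infinity>x. (real (local_time n x w))\<^sup>2)"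
    proof (rule infsum_mono_neutral)
      \<comment> \<open>Only the finitely many visited sites contribute, so the infinite sum is a
        genuine one and not the default value 0.\<close>
      have "x \<in> (\<lambda>i. srw i w) ` {0..n}" if "local_time n x w \<noteq> 0" for x
        using that by (auto simp: local_time_def)
      then have "(\<lambda>x. (real (local_time n x w))\<^sup>2) summable_on (\<lambda>i. srw i w) ` {0..n} \<longleftrightarrow>
          (\<lambda>x. (real (local_time n x w))\<^sup>2) summable_on UNIV"
        by (intro summable_on_cong_neutral) auto
      then show "(\<lambda>x. (real (local_time n x w))\<^sup>2) summable_on UNIV" by simp
    qed auto
    finally show ?thesis .
  qed
  then have "{w. \<forall>i<2 * q. w i = v i} \<subseteq> {w. (real q)\<^sup>2 \<le> (\<Sum>\<^sub>\<infinity>x. (real (local_time n x w))\<^sup>2)}"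
    by blast
  moreover have "{w \<in> space ?S. (real q)\<^sup>2 \<le> (\<Sum>\<^sub>\<infinity>x. (real (local_time n x w))\<^sup>2)} \<in> sets ?S"
    unfolding infsum_local_time_sq by measurable
  ultimately have "\<P>(w in ?S. \<forall>i<2 * q. w i = v i) \<le>
      \<P>(w in ?S. (real q)\<^sup>2 \<le> (\<Sum>\<^sub>\<infinity>x. (real (local_time n x w))\<^sup>2))"
    by (intro srw.finite_measure_mono) auto
  then show ?thesis by (subst (asm) prob_prefix_eq[OF v])
qed

lemma eventually_prob_local_time_sq_ge:
  assumes "0 \<le> y"
  shows "\<exists>c>0. \<forall>\<^sub>F n in sequentially.
    exp (- c * sqrt (real n)) \<le> \<P>(w in (srw_law :: (nat \<Rightarrow> int ^ 'd::finite) measure).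
      (\<Sum>\<^sub>\<infinity>x. (real (local_time n x w))\<^sup>2) \<ge> real n * y)"
proof -
  define C where "C = real (card (unit_steps :: (int ^ 'd) set))"
  have C: "1 \<le> C" using card_unit_steps_pos[where 'd = 'd] unfolding C_def by linarith
  \<comment> \<open>About \<open>(2 * sqrt y + 2) * sqrt n\<close> steps are prescribed at a cost of
    \<open>ln C\<close> each; the added 1 keeps \<open>c\<close> positive when only
    \<open>ln C \<ge> 0\<close> is known.\<close>
  define c where "c = (2 * sqrt y + 2) * ln C + 1"
  have c: "0 < c" using C assms by (simp add: c_def add_nonneg_pos)
  \<comment> \<open>This leaves room for the \<open>2 * q\<close> prescribed steps within time
    \<open>n\<close>, rounding up included.\<close>
  have "\<forall>\<^sub>F n in sequentially. 2 * (sqrt y * sqrt (real n)) + 2 \<le> real n"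
    by real_asymp
  then have "\<forall>\<^sub>F n in sequentially.
    exp (- c * sqrt (real n)) \<le> \<P>(w in (srw_law :: (nat \<Rightarrow> int ^ 'd::finite) measure).
      (\<Sum>\<^sub>\<infinity>x. (real (local_time n x w))\<^sup>2) \<ge> real n * y)"
    using eventually_gt_at_top[of 0]
  proof eventually_elim
    case (elim n)
    define q where "q = nat \<lceil>sqrt y * sqrt (real n)\<rceil>"
    have q: "sqrt y * sqrt (real n) \<le> real q" "real q \<le> sqrt y * sqrt (real n) + 1"
      using assms by (auto simp: q_def)
    have "real n * y = (sqrt y * sqrt (real n))\<^sup>2"
      using assms by (simp add: power_mult_distrib)
    also have "\<dots> \<le> (real q)\<^sup>2" using q assms by (intro power_mono) auto
    finally have nq: "real n * y \<le> (real q)\<^sup>2" .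
    have "1 \<le> sqrt (real n)" using elim by simp
    moreover have "(2 * sqrt y + 2) * sqrt (real n) = 2 * (sqrt y * sqrt (real n)) + 2
        * sqrt (real n)"
      by (simp add: algebra_simps)
    ultimately have "2 * real q \<le> (2 * sqrt y + 2) * sqrt (real n)"
      using q by linarith
    then have "2 * real q * ln C \<le> (2 * sqrt y + 2) * sqrt (real n) * ln C"
      using C by (intro mult_right_mono) auto
    also have "\<dots> \<le> c * sqrt (real n)" by (simp add: c_def algebra_simps)
    finally have "exp (- c * sqrt (real n)) \<le> exp (- (2 * real q * ln C))" by simp
    also have "\<dots> = (1 / C) ^ (2 * q)"
      using C by (simp add: exp_minus exp_of_nat_mult[of "2 * q" "ln C", simplified]
          power_divide inverse_eq_divide)
    also have "\<dots> \<le> \<P>(w in (srw_law :: (nat \<Rightarrow> int ^ 'd::finite) measure).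
      (real q)\<^sup>2 \<le> (\<Sum>\<^sub>\<infinity>x. (real (local_time n x w))\<^sup>2))"
      unfolding C_def using q elim by (intro prob_local_time_sq_ge) linarith
    also have "\<dots> \<le> \<P>(w in (srw_law :: (nat \<Rightarrow> int ^ 'd::finite) measure).
      (\<Sum>\<^sub>\<infinity>x. (real (local_time n x w))\<^sup>2) \<ge> real n * y)"
    proof (rule srw.finite_measure_mono)
      show "{w \<in> space srw_law. real n * y \<le> (\<Sum>\<^sub>\<infinity>x::int ^ 'd. (real (local_time n x w))\<^sup>2)}
          \<in> srw.events"
        unfolding infsum_local_time_sq by measurable
    qed (use nq in auto)
    finally show ?case .
  qed
  then show ?thesis using c by blast
qed

section \<open>From the extended-real hypothesis to the theorem\<close>

text \<open>One infinite value of \<open>green\<close> would make the sum of squares infinite, so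
  everything can be moved to the reals.\<close>

lemma green_l2I:
  assumes "(\<Sum>\<^sub>\<infinity>x::int ^ 'd::finite. (green x)\<^sup>2) < \<infinity>"
  shows "green_l2 TYPE('d) (enn2real (\<Sum>\<^sub>\<infinity>x::int ^ 'd. (green x)\<^sup>2))"
proof -
  have le: "(\<Sum>x\<in>F. (green x)\<^sup>2) \<le> (\<Sum>\<^sub>\<infinity>x::int ^ 'd. (green x)\<^sup>2)" if "finite F"
      for F :: "(int ^ 'd) set"
  proof -
    have "infsum (\<lambda>x::int ^ 'd. (green x)\<^sup>2) F \<le> (\<Sum>\<^sub>\<infinity>x::int ^ 'd. (green x)\<^sup>2)"
      by (rule infsum_mono_neutral) (auto intro!: nonneg_summable_on_complete)
    then show ?thesis using that by simp
  qed
  have fin: "green x < \<infinity>" for x :: "int ^ 'd"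
  proof (rule ccontr)
    assume "\<not> green x < \<infinity>"
    then have "green x = \<top>" by (simp add: less_top[symmetric])
    then show False using le[of "{x}"] assms by (simp add: top_unique power2_eq_square)
  qed
  show ?thesis
  proof
    fix F :: "(int ^ 'd) set" assume F: "finite F"
    have "ennreal (\<Sum>x\<in>F. (greenr x)\<^sup>2) = (\<Sum>x\<in>F. (green x)\<^sup>2)"
      using fin by (subst sum_ennreal[symmetric]) (auto simp: greenr_def simp flip: ennreal_power)
    also have "\<dots> \<le> ennreal (enn2real (\<Sum>\<^sub>\<infinity>x::int ^ 'd. (green x)\<^sup>2))"
      using le[OF F] assms by simp
    finally show "(\<Sum>x\<in>F. (greenr x)\<^sup>2) \<le> enn2real (\<Sum>\<^sub>\<infinity>x::int ^ 'd. (green x)\<^sup>2)"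
      by (simp add: ennreal_le_iff)
  qed (rule fin)
qed

theorem proposition1p4:
  fixes y :: real
  assumes "CARD('d::finite) \<ge> 5"
    and "ennreal y > 1 + 2 * (\<Sum>\<^sub>\<infinity>x::int ^ 'd. (green x)\<^sup>2)"
  shows "\<exists>c_lower>0. \<exists>c_upper>0. \<forall>\<^sub>F n in sequentially.
    exp (- c_upper * sqrt (real n))
      \<ge> \<P>(\<omega> in (srw_law :: (nat \<Rightarrow> int ^ 'd) measure).
           (\<Sum>\<^sub>\<infinity>x. (real (local_time n x \<omega>))\<^sup>2) \<ge> real n * y) \<and>
    \<P>(\<omega> in (srw_law :: (nat \<Rightarrow> int ^ 'd) measure).
           (\<Sum>\<^sub>\<infinity>x. (real (local_time n x \<omega>))\<^sup>2) \<ge> real n * y)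
      \<ge> exp (- c_lower * sqrt (real n))"
proof -
  let ?B = "\<Sum>\<^sub>\<infinity>x::int ^ 'd. (green x)\<^sup>2"
  have "?B \<noteq> \<infinity>"
  proof
    assume "?B = \<infinity>"
    then have "1 + 2 * ?B = \<infinity>" by (simp add: ennreal_mult_top)
    then show False using assms(2) by simp
  qed
  then have fin: "?B < \<infinity>" by (simp add: less_top)
  then interpret green_l2 "TYPE('d)" "enn2real ?B"
    by (rule green_l2I)
  have "ennreal (1 + 2 * enn2real ?B) = 1 + 2 * ?B"
    using fin by (simp add: ennreal_mult')
  then have "ennreal (1 + 2 * enn2real ?B) < ennreal y" using assms(2) by simp
  then have y: "1 + 2 * enn2real ?B < y"
    using B_pos by (subst (asm) ennreal_less_iff) auto
  then have "0 \<le> y" using B_pos by linarith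
  obtain c_upper where "0 < c_upper" and upper: "\<forall>\<^sub>F n in sequentially.
    \<P>(\<omega> in (srw_law :: (nat \<Rightarrow> int ^ 'd) measure).
      (\<Sum>\<^sub>\<infinity>x. (real (local_time n x \<omega>))\<^sup>2) \<ge> real n * y) \<le> exp (- c_upper * sqrt (real n))"
    using eventually_prob_local_time_sq_le[OF y] by blast
  obtain c_lower where "0 < c_lower" and lower: "\<forall>\<^sub>F n in sequentially.
    exp (- c_lower * sqrt (real n)) \<le> \<P>(\<omega> in (srw_law :: (nat \<Rightarrow> int ^ 'd) measure).
      (\<Sum>\<^sub>\<infinity>x. (real (local_time n x \<omega>))\<^sup>2) \<ge> real n * y)"
    using eventually_prob_local_time_sq_ge[OF \<open>0 \<le> y\<close>] by blast
  show ?thesis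
    using eventually_conj[OF upper lower] \<open>0 < c_upper\<close> \<open>0 < c_lower\<close> by blast
qed

end
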